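(* Let $E$ be an almost product structure on a $3$-Bihom-Lie algebra $(L,[\cdot,\cdot,\cdot],\alpha,\beta)$ over a field $\mathbb{K}$. Put $L_+=\{x\in L\mid Ex=x\}$ and $L_-=\{x\in L\mid Ex=-x\}$. If $$E[x,y,z]=[Ex,Ey,Ez]\quad\text{for all }x,y,z\in L,$$ then $E$ is a product structure on $L$ such that $[L_+,L_+,L_-]\subseteq L_-$ and $[L_-,L_-,L_+]\subseteq L_+$.
   Context: A $3$-Bihom-Lie algebra over a field $\mathbb{K}$ is a $4$-tuple $(L,[\cdot,\cdot,\cdot],\alpha,\beta)$ consisting of a $\mathbb{K}$-vector space $L$, a $3$-linear map $[\cdot,\cdot,\cdot]\colon L\times L\times L\to L$ and two linear maps $\alpha,\beta\colon L\to L$ such that for all $x,y,z,u,v\in L$: (1) $\alpha\beta=\beta\alpha$; (2) $\alpha([x,y,z])=[\alpha(x),\alpha(y),\alpha(z)]$ and $\beta([x,y,z])=[\beta(x),\beta(y),\beta(z)]$; (3) $[\beta(x),\beta(y),\alpha(z)]=-[\beta(y),\beta(x),\alpha(z)]=-[\beta(x),\beta(z),\alpha(y)]$; (4) $[\beta^2(u),\beta^2(v),[\beta(x),\beta(y),\alpha(z)]]=[\beta^2(y),\beta^2(z),[\beta(u),\beta(v),\alpha(x)]]-[\beta^2(x),\beta^2(z),[\beta(u),\beta(v),\alpha(y)]]+[\beta^2(x),\beta^2(y),[\beta(u),\beta(v),\alpha(z)]]$. An almost product structure on $L$ is a linear map $E\colon L\to L$ with $E^2=\mathrm{Id}$, $E\neq\pm\mathrm{Id}$,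 $\alpha E=E\alpha$ and $\beta E=E\beta$. It is a product structure if for all $x,y,z\in L$, $$E[x,y,z]=[Ex,Ey,Ez]+[Ex,y,z]+[x,Ey,z]+[x,y,Ez]-E[Ex,Ey,z]-E[x,Ey,Ez]-E[Ex,y,Ez].$$ For subspaces $A,B,C\subseteq L$, $[A,B,C]$ denotes the span of all $[a,b,c]$ with $a\in A$, $b\in B$, $c\in C$. *)

theory Defs
  imports Main "HOL.Vector_Spaces"
begin

text \<open>
  The underlying vector space is the whole type \<open>'a\<close>, with scalar multiplication \<open>scale\<close> over an
  arbitrary field \<open>'k\<close> (of any characteristic and any dimension).
\<close>

definition trilinear ::
  "('k::field \<Rightarrow> 'a::ab_group_add \<Rightarrow> 'a) \<Rightarrow> ('a \<Rightarrow> 'a \<Rightarrow> 'a \<Rightarrow> 'a) \<Rightarrow> bool" where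
  "trilinear scale br \<longleftrightarrow>
     (\<forall>y z. Vector_Spaces.linear scale scale (\<lambda>x. br x y z)) \<and>
     (\<forall>x z. Vector_Spaces.linear scale scale (\<lambda>y. br x y z)) \<and>
     (\<forall>x y. Vector_Spaces.linear scale scale (\<lambda>z. br x y z))"

locale three_bihom_lie_algebra = vector_space scale
  for scale :: "'k::field \<Rightarrow> 'a::ab_group_add \<Rightarrow> 'a" +
  fixes br :: "'a \<Rightarrow> 'a \<Rightarrow> 'a \<Rightarrow> 'a"
    and \<alpha> \<beta> :: "'a \<Rightarrow> 'a"
  assumes trilinear_br: "trilinear scale br"
    and linear_\<alpha>: "Vector_Spaces.linear scale scale \<alpha>"
    and linear_\<beta>: "Vector_Spaces.linear scale scale \<beta>"
    and commute: "\<alpha> \<circ> \<beta> = \<beta> \<circ> \<alpha>"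
    and \<alpha>_br: "\<alpha> (br x y z) = br (\<alpha> x) (\<alpha> y) (\<alpha> z)"
    and \<beta>_br: "\<beta> (br x y z) = br (\<beta> x) (\<beta> y) (\<beta> z)"
    and skew_12: "br (\<beta> x) (\<beta> y) (\<alpha> z) = - br (\<beta> y) (\<beta> x) (\<alpha> z)"
    and skew_23: "br (\<beta> x) (\<beta> y) (\<alpha> z) = - br (\<beta> x) (\<beta> z) (\<alpha> y)"
    and jacobi:
      "br (\<beta> (\<beta> u)) (\<beta> (\<beta> v)) (br (\<beta> x) (\<beta> y) (\<alpha> z)) =
         br (\<beta> (\<beta> y)) (\<beta> (\<beta> z)) (br (\<beta> u) (\<beta> v) (\<alpha> x))
       - br (\<beta> (\<beta> x)) (\<beta> (\<beta> z)) (br (\<beta> u) (\<beta> v) (\<alpha> y))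
       + br (\<beta> (\<beta> x)) (\<beta> (\<beta> y)) (br (\<beta> u) (\<beta> v) (\<alpha> z))"

definition almost_product_structure ::
  "('k::field \<Rightarrow> 'a::ab_group_add \<Rightarrow> 'a) \<Rightarrow> ('a \<Rightarrow> 'a) \<Rightarrow> ('a \<Rightarrow> 'a) \<Rightarrow> ('a \<Rightarrow> 'a) \<Rightarrow> bool" where
  "almost_product_structure scale \<alpha> \<beta> E \<longleftrightarrow>
     Vector_Spaces.linear scale scale E \<and>
     E \<circ> E = id \<and> E \<noteq> id \<and> E \<noteq> (\<lambda>x. - x) \<and>
     \<alpha> \<circ> E = E \<circ> \<alpha> \<and> \<beta> \<circ> E = E \<circ> \<beta>"

definition product_structure ::
  "('k::field \<Rightarrow> 'a::ab_group_add \<Rightarrow> 'a) \<Rightarrow> ('a \<Rightarrow> 'a \<Rightarrow> 'a \<Rightarrow> 'a) \<Rightarrow>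
   ('a \<Rightarrow> 'a) \<Rightarrow> ('a \<Rightarrow> 'a) \<Rightarrow> ('a \<Rightarrow> 'a) \<Rightarrow> bool" where
  "product_structure scale br \<alpha> \<beta> E \<longleftrightarrow>
     almost_product_structure scale \<alpha> \<beta> E \<and>
     (\<forall>x y z. E (br x y z) =
        br (E x) (E y) (E z) + br (E x) y z + br x (E y) z + br x y (E z)
        - E (br (E x) (E y) z) - E (br x (E y) (E z)) - E (br (E x) y (E z)))"

definition plus_space :: "('a \<Rightarrow> 'a) \<Rightarrow> 'a set" where
  "plus_space E = {x. E x = x}"

definition minus_space :: "('a::ab_group_add \<Rightarrow> 'a) \<Rightarrow> 'a set" where
  "minus_space E = {x. E x = - x}"

definition bracket_span ::
  "('k::field \<Rightarrow> 'a::ab_group_add \<Rightarrow> 'a) \<Rightarrow> ('a \<Rightarrow> 'a \<Rightarrow> 'a \<Rightarrow> 'a) \<Rightarrow>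
   'a set \<Rightarrow> 'a set \<Rightarrow> 'a set \<Rightarrow> 'a set" where
  "bracket_span scale br A B C =
     module.span scale {br a b c | a b c. a \<in> A \<and> b \<in> B \<and> c \<in> C}"

end

theory Submission
  imports Defs
begin

text \<open>The hypothesis makes \<open>E\<close> an involution that respects the bracket. Moving
  \<open>E\<close> inside a bracket and using \<open>E (E x) = x\<close> turns each term such as
  \<open>E (br (E x) (E y) z)\<close> into \<open>br x y (E z)\<close>, so the six mixed terms of
  the product identity cancel in pairs. On eigenvectors of \<open>E\<close> the bracket is again an
  eigenvector, whose sign is the product of the three signs: one factor from the minus space gives
  -1, two give +1. Linearity of \<open>E\<close> makes the eigenspaces subspaces, so these facts
  extend from brackets to their span.\<close>

context vector_space
begin

lemma subspace_plus_space:
  assumes "Vector_Spaces.linear scale scale E"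
  shows "subspace (plus_space E)"
proof -
  interpret E: Vector_Spaces.linear scale scale E by (rule assms)
  show ?thesis
    by (auto simp: plus_space_def subspace_def E.zero E.add E.scale)
qed

lemma subspace_minus_space:
  assumes "Vector_Spaces.linear scale scale E"
  shows "subspace (minus_space E)"
proof -
  interpret E: Vector_Spaces.linear scale scale E by (rule assms)
  show ?thesis
    by (auto simp: minus_space_def subspace_def E.zero E.add E.scale)
qed

text \<open>The span is the least subspace containing the generating brackets, so an inclusion into
  a subspace need only be tested on single brackets.\<close>

lemma bracket_span_subsetI:
  assumes "subspace S" and "\<And>a b c. a \<in> A \<Longrightarrow> b \<in> B \<Longrightarrow> c \<in> C \<Longrightarrow> br a b c \<in> S"
  shows "bracket_span scale br A B C \<subseteq> S"
  unfolding bracket_span_def using assms by (intro span_minimal) auto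

end

text \<open>Used to pull out the signs that \<open>E\<close> produces on arguments from the minus
  space.\<close>

lemma trilinear_minus:
  assumes "trilinear scale br"
  shows "br (- x) y z = - br x y z"
    and "br x (- y) z = - br x y z"
    and "br x y (- z) = - br x y z"
proof -
  interpret l1: Vector_Spaces.linear scale scale "\<lambda>x. br x y z"
    using assms by (simp add: trilinear_def)
  interpret l2: Vector_Spaces.linear scale scale "\<lambda>y. br x y z"
    using assms by (simp add: trilinear_def)
  interpret l3: Vector_Spaces.linear scale scale "\<lambda>z. br x y z"
    using assms by (simp add: trilinear_def)
  show "br (- x) y z = - br x y z" by (rule l1.neg)
  show "br x (- y) z = - br x y z" by (rule l2.neg)
  show "br x y (- z) = - br x y z" by (rule l3.neg)
qed

theorem proposition3p14:
  fixes scale :: "'k::field \<Rightarrow> 'a::ab_group_add \<Rightarrow> 'a"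
    and br :: "'a \<Rightarrow> 'a \<Rightarrow> 'a \<Rightarrow> 'a"
    and \<alpha> \<beta> E :: "'a \<Rightarrow> 'a"
  assumes "three_bihom_lie_algebra scale br \<alpha> \<beta>"
    and "almost_product_structure scale \<alpha> \<beta> E"
    and "\<forall>x y z. E (br x y z) = br (E x) (E y) (E z)"
  shows "product_structure scale br \<alpha> \<beta> E \<and>
    bracket_span scale br (plus_space E) (plus_space E) (minus_space E) \<subseteq> minus_space E \<and>
    bracket_span scale br (minus_space E) (minus_space E) (plus_space E) \<subseteq> plus_space E"
proof -
  interpret three_bihom_lie_algebra scale br \<alpha> \<beta> by (rule assms(1))
  note E_br = assms(3)[rule_format]
  have lin: "Vector_Spaces.linear scale scale E" and "E \<circ> E = id"
    using assms(2) by (simp_all add: almost_product_structure_def)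
  then have EE: "E (E x) = x" for x
    by (simp add: pointfree_idE)
  \<comment> \<open>After rewriting, both sides reduce to \<open>br (E x) (E y) (E z)\<close>: the
    three brackets with one \<open>E\<close> cancel against the three with two.\<close>
  have "product_structure scale br \<alpha> \<beta> E"
    using assms(2) by (simp add: product_structure_def E_br EE)
  \<comment> \<open>Only the third argument changes sign:
    \<open>E (br a b c) = br a b (- c) = - br a b c\<close>.\<close>
  moreover have "bracket_span scale br (plus_space E) (plus_space E) (minus_space E) \<subseteq> minus_space E"
    by (rule bracket_span_subsetI[OF subspace_minus_space[OF lin]])
      (simp add: plus_space_def minus_space_def E_br trilinear_minus[OF trilinear_br])
  \<comment> \<open>Here two signs cancel:
    \<open>E (br a b c) = br (- a) (- b) c = br a b c\<close>.\<close>
  moreover have "bracket_span scale br (minus_space E) (minus_space E) (plus_space E) \<subseteq> plus_space E"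
    by (rule bracket_span_subsetI[OF subspace_plus_space[OF lin]])
      (simp add: plus_space_def minus_space_def E_br trilinear_minus[OF trilinear_br])
  ultimately show ?thesis by blast
qed

end
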